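(* Let $n\ge 0$ and let $m_0>m_1>\cdots>m_n\ge 0$ be integers. Let $V\subseteq\mathbb{R}[t]$ be the linear span of the monomials $t^{m_0},\dots,t^{m_n}$. Let (a) $I=[0,1]$ or (b) $I=[0,\infty[$, and let $P=\{f\in V : f\ge 0 \text{ on } I\}$. Then every $f\in P$ can be written as a finite sum of the form $$\text{(a)}\quad f=\sum_i g_i(t)^2p_i(t)+(1-t)\sum_j h_j(t)^2q_j(t),$$ $$\text{(b)}\quad f=\sum_i g_i(t)^2p_i(t),$$ respectively, where $g_i,p_i,h_j,q_j\in\mathbb{R}[t]$ are polynomials with $\deg(g_i),\deg(h_j)\le\lfloor n/2\rfloor$, such that every summand (that is, each $g_i^2p_i$ and, in case (a), each $(1-t)h_j^2q_j$) has degree $\le m_0$, and such that all coefficients of all $p_i$ and $q_j$ are non-negative.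
   Context: The zero polynomial has degree $-\infty$. *)

theory Defs
  imports Complex_Main "HOL-Computational_Algebra.Polynomial"
begin

interpretation real_poly: vector_space "smult :: real \<Rightarrow> real poly \<Rightarrow> real poly"
  by unfold_locales (simp_all add: smult_add_right smult_add_left)

definition monomial_space :: "nat \<Rightarrow> (nat \<Rightarrow> nat) \<Rightarrow> real poly set" where
  "monomial_space n m = real_poly.span ((\<lambda>i. monom 1 (m i)) ` {..n})"

definition nonneg_on :: "real set \<Rightarrow> real poly set \<Rightarrow> real poly set" where
  "nonneg_on I V = {f \<in> V. \<forall>t\<in>I. poly f t \<ge> 0}"

definition nonneg_coeffs :: "real poly \<Rightarrow> bool" where
  "nonneg_coeffs p \<longleftrightarrow> (\<forall>k. coeff p k \<ge> 0)"

(* The library sets "degree 0 = 0", while the text uses degree minus infinity for the zero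
   polynomial.  Below, degrees only occur in bounds "degree p \<le> d" with d a natural number,
   and the zero polynomial satisfies these under both conventions. *)

(* Finite sums are indexed by i < r and j < s; r = 0 or s = 0 gives an empty sum.
   The polynomial [:1, -1:] is 1 - t. *)

definition has_representation_a :: "nat \<Rightarrow> nat \<Rightarrow> real poly \<Rightarrow> bool" where
  "has_representation_a d M f \<longleftrightarrow>
    (\<exists>(r::nat) (s::nat) (g :: nat \<Rightarrow> real poly) p h q.
      f = (\<Sum>i<r. g i ^ 2 * p i) + [:1, -1:] * (\<Sum>j<s. h j ^ 2 * q j) \<and>
      (\<forall>i<r. degree (g i) \<le> d \<and> degree (g i ^ 2 * p i) \<le> M \<and> nonneg_coeffs (p i)) \<and>
      (\<forall>j<s. degree (h j) \<le> d \<and> degree ([:1, -1:] * (h j ^ 2 * q j)) \<le> M \<and>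
             nonneg_coeffs (q j)))"

definition has_representation_b :: "nat \<Rightarrow> nat \<Rightarrow> real poly \<Rightarrow> bool" where
  "has_representation_b d M f \<longleftrightarrow>
    (\<exists>(r::nat) (g :: nat \<Rightarrow> real poly) p.
      f = (\<Sum>i<r. g i ^ 2 * p i) \<and>
      (\<forall>i<r. degree (g i) \<le> d \<and> degree (g i ^ 2 * p i) \<le> M \<and> nonneg_coeffs (p i)))"

end

theory Submission
  imports Defs
begin

text \<open>
  Multiplication by \<open>x - t\<close> with \<open>x > 0\<close> adds a sign change to the coefficient sequence (Descartes).
  A polynomial with \<open>n + 1\<close> terms has at most \<open>n\<close> sign changes, so if it is divisible by a product of
  \<open>n\<close> such factors, then the cofactor has coefficients of constant sign; and for any prescribed
  \<open>n\<close> positive zeros and \<open>n + 1\<close> exponents such a polynomial exists. Given a nonnegative \<open>f\<close>, choose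
  such an \<open>h\<close> having all known zeros of \<open>f\<close>, the missing ones being put at \<open>1\<close> (on the half-line an
  exponent is left out if \<open>n\<close> is odd); then \<open>h\<close> is itself of the form of one summand.
  Subtract the largest multiple of \<open>h\<close> that keeps \<open>f\<close> nonnegative.
  The difference has an additional zero, or has lost its lowest or (on the half-line) its highest term,
  so induction on the number of terms and missing zeros applies.
\<close>

section \<open>Supports, products of linear factors and alternating coefficients\<close>

definition supported_on :: "nat set \<Rightarrow> 'a::zero poly \<Rightarrow> bool" where
  "supported_on S p \<longleftrightarrow> (\<forall>k. coeff p k \<noteq> 0 \<longrightarrow> k \<in> S)"

text \<open>The factors are \<open>x - t\<close> rather than \<open>t - x\<close>, so that the
  weight \<open>1 - t\<close> is one of them. Repeated list entries record multiplicities.\<close>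

definition linear_prod :: "real list \<Rightarrow> real poly" where
  "linear_prod xs = (\<Prod>x\<leftarrow>xs. [:x, -1:])"

text \<open>Expresses that the coefficient sequence has at least \<open>k\<close> sign changes,
  witnessed by \<open>k + 1\<close> increasing positions. Only the sign of \<open>s\<close> matters:
  it is the sign at the first position.\<close>

definition alternates :: "real \<Rightarrow> nat \<Rightarrow> real poly \<Rightarrow> bool" where
  "alternates s k p \<longleftrightarrow> (\<exists>i. (\<forall>j<k. i j < i (Suc j)) \<and> (\<forall>j\<le>k. s * (-1) ^ j * coeff p (i j) > 0))"

lemma supported_on_0 [simp]: "supported_on S 0"
  by (simp add: supported_on_def)

lemma supported_on_diff_smult:
  fixes p q :: "real poly"
  assumes "supported_on S p" "supported_on S q"
  shows "supported_on S (p - smult c q)"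
  using assms unfolding supported_on_def by (metis coeff_diff coeff_smult diff_self mult_zero_right)

lemma supported_on_mono: "supported_on S p \<Longrightarrow> S \<subseteq> T \<Longrightarrow> supported_on T p"
  by (auto simp: supported_on_def)

lemma supported_on_remove: "supported_on S p \<Longrightarrow> coeff p a = 0 \<Longrightarrow> supported_on (S - {a}) p"
  by (auto simp: supported_on_def)

lemma supported_on_degree_le: "supported_on S p \<Longrightarrow> (\<And>k. k \<in> S \<Longrightarrow> k \<le> M) \<Longrightarrow> degree p \<le> M"
  by (rule degree_le) (metis supported_on_def not_less)

lemma linear_prod_Nil [simp]: "linear_prod [] = 1"
  and linear_prod_Cons [simp]: "linear_prod (x # xs) = [:x, -1:] * linear_prod xs"
  and linear_prod_append [simp]: "linear_prod (xs @ ys) = linear_prod xs * linear_prod ys"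
  and linear_prod_replicate [simp]: "linear_prod (replicate k x) = [:x, -1:] ^ k"
  by (simp_all add: linear_prod_def prod_list_replicate)

lemma linear_prod_nonzero [simp]: "linear_prod xs \<noteq> 0"
  by (induction xs) (auto simp del: mult_pCons_left)

lemma degree_linear_prod: "degree (linear_prod xs) = length xs"
  by (induction xs) (auto simp: degree_mult_eq simp del: mult_pCons_left)

lemma poly_linear_prod_0: "(\<And>x. x \<in> set xs \<Longrightarrow> x > 0) \<Longrightarrow> poly (linear_prod xs) 0 \<noteq> 0"
  by (induction xs) force+

section \<open>Descartes' rule of signs\<close>

lemma coeff_linear_mult_Suc: "coeff ([:x, -1:] * p) (Suc j) = x * coeff p (Suc j) - coeff p j"
  for x :: real
  by simp

text \<open>Were all coefficients of the product \<le> 0 up to \<open>b\<close>, then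
  \<open>x * coeff p (Suc j) \<le> coeff p j\<close> would propagate nonpositivity from index 0 up
  to \<open>b\<close>.\<close>

lemma linear_mult_pos_coeff_le:
  fixes x :: real
  assumes "x > 0" "coeff p b > 0"
  shows "\<exists>j\<le>b. coeff ([:x, -1:] * p) j > 0"
proof (rule ccontr)
  assume *: "\<not> ?thesis"
  have "c \<le> b \<Longrightarrow> coeff p c \<le> 0" for c
  proof (induction c)
    case 0
    then have "x * coeff p 0 \<le> 0" using * by (force simp: not_less)
    then show ?case using assms by (simp add: mult_le_0_iff)
  next
    case (Suc c)
    then have "x * coeff p (Suc c) - coeff p c \<le> 0"
      using * by (metis coeff_linear_mult_Suc not_less)
    with Suc have "x * coeff p (Suc c) \<le> 0" by simp
    then show ?case using assms by (simp add: mult_le_0_iff)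
  qed
  then show False using assms by fastforce
qed

text \<open>The same propagation of nonpositivity, now started at index \<open>a\<close>.\<close>

lemma linear_mult_pos_coeff_between:
  fixes x :: real
  assumes "x > 0" "coeff p a \<le> 0" "coeff p b > 0" "a < b"
  shows "\<exists>j. a < j \<and> j \<le> b \<and> coeff ([:x, -1:] * p) j > 0"
proof (rule ccontr)
  assume *: "\<not> ?thesis"
  have "c \<ge> a \<Longrightarrow> c \<le> b \<Longrightarrow> coeff p c \<le> 0" for c
  proof (induction c rule: dec_induct)
    case base
    then show ?case using assms by simp
  next
    case (step c)
    then have "x * coeff p (Suc c) - coeff p c \<le> 0"
      using * by (metis coeff_linear_mult_Suc not_less le_imp_less_Suc)
    with step have "x * coeff p (Suc c) \<le> 0" by simp
    then show ?case using assms by (simp add: mult_le_0_iff)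
  qed
  from this[of b] show False using assms by simp
qed

text \<open>Otherwise positivity would propagate from \<open>a\<close> to all larger indices, beyond
  the degree of \<open>p\<close>.\<close>

lemma linear_mult_neg_coeff_gt:
  fixes x :: real
  assumes "x > 0" "coeff p a > 0"
  shows "\<exists>j>a. coeff ([:x, -1:] * p) j < 0"
proof (rule ccontr)
  assume *: "\<not> ?thesis"
  have "c \<ge> a \<Longrightarrow> coeff p c > 0" for c
  proof (induction c rule: dec_induct)
    case base
    then show ?case using assms by simp
  next
    case (step c)
    then have "x * coeff p (Suc c) - coeff p c \<ge> 0"
      using * by (metis coeff_linear_mult_Suc not_less le_imp_less_Suc)
    with step have "x * coeff p (Suc c) > 0" by simp
    then show ?case using assms by (simp add: zero_less_mult_iff)
  qed
  from this[of "max a (Suc (degree p))"] show False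
    by (simp add: coeff_eq_0)
qed

text \<open>One new position lies at or below \<open>i 0\<close>, one after each
  \<open>i (j - 1)\<close> and up to \<open>i j\<close>, and one beyond \<open>i k\<close>; the last
  supplies the additional sign change.\<close>

lemma alternates_linear_mult:
  assumes x: "x > 0" and "alternates s k p"
  shows "alternates s (Suc k) ([:x, -1:] * p)"
proof -
  from assms obtain i where i: "\<And>j. j < k \<Longrightarrow> i j < i (Suc j)"
    and s: "\<And>j. j \<le> k \<Longrightarrow> s * (-1) ^ j * coeff p (i j) > 0"
    unfolding alternates_def by blast
  define q where "q = [:x, -1:] * p"
  have q: "[:x, -1:] * smult c p = smult c q" for c
    by (simp add: q_def)
  \<comment> \<open>The bounds on \<open>l\<close> are part of the claim because they make the
    separately chosen positions increasing.\<close>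
  have "\<exists>l. (j \<le> k \<longrightarrow> l \<le> i j) \<and> (j > 0 \<longrightarrow> i (j - 1) < l) \<and> s * (-1) ^ j * coeff q l > 0"
    if j: "j \<le> Suc k" for j
  proof -
    consider "j = 0" | j' where "j = Suc j'" "j \<le> k" | "j = Suc k"
      using j by (cases j) force+
    then show ?thesis
    proof cases
      case 1
      then show ?thesis
        using linear_mult_pos_coeff_le[OF x, of "smult s p" "i 0"] s[of 0]
        unfolding q by auto
    next
      case 2
      have "coeff (smult (s * (-1) ^ j) p) (i j') \<le> 0" using s[of j'] 2 by simp
      then show ?thesis
        using linear_mult_pos_coeff_between[OF x, of "smult (s * (-1) ^ j) p" "i j'" "i j"]
          s[of j] i[of j'] 2
        unfolding q by (auto simp: ac_simps)
    next
      case 3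
      then show ?thesis
        using linear_mult_neg_coeff_gt[OF x, of "smult (s * (-1) ^ k) p" "i k"] s[of k]
        unfolding q by auto
    qed
  qed
  then obtain l where l: "\<And>j. j \<le> Suc k \<Longrightarrow>
      (j \<le> k \<longrightarrow> l j \<le> i j) \<and> (j > 0 \<longrightarrow> i (j - 1) < l j) \<and> s * (-1) ^ j * coeff q (l j) > 0"
    by metis
  have "l j < l (Suc j)" if "j < Suc k" for j
    using l[of j] l[of "Suc j"] that by force
  with l show ?thesis
    unfolding alternates_def q_def[symmetric] by blast
qed

lemma alternates_linear_prod_mult:
  assumes "\<And>x. x \<in> set xs \<Longrightarrow> x > 0" "alternates s k p"
  shows "alternates s (k + length xs) (linear_prod xs * p)"
  using assms
proof (induction xs)
  case (Cons x xs)
  then show ?case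
    using alternates_linear_mult[of x s "k + length xs" "linear_prod xs * p"]
    by (simp add: mult.assoc del: mult_pCons_left)
qed simp

lemma alternates_less_card:
  assumes "alternates s k p" "supported_on S p" "finite S"
  shows "k < card S"
proof -
  from assms obtain i where i: "\<And>j. j < k \<Longrightarrow> i j < i (Suc j)"
    and s: "\<And>j. j \<le> k \<Longrightarrow> s * (-1) ^ j * coeff p (i j) > 0"
    unfolding alternates_def by blast
  have less: "j < l \<Longrightarrow> l \<le> k \<Longrightarrow> i j < i l" for j l
  proof (induction l)
    case (Suc l)
    then show ?case using i[of l] by (cases "j = l") force+
  qed simp
  have "inj_on i {..k}"
    by (rule inj_onI) (metis atMost_iff less less_irrefl linorder_neqE_nat)
  moreover have "i ` {..k} \<subseteq> S"
    
  proof (rule image_subsetI)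
    fix j assume "j \<in> {..k}"
    then have "coeff p (i j) \<noteq> 0" using s[of j] by auto
    then show "i j \<in> S" using assms(2) by (simp add: supported_on_def)
  qed
  ultimately have "card {..k} \<le> card S" using card_inj_on_le assms(3) by blast
  then show ?thesis by simp
qed

lemma alternates_0:
  assumes "p \<noteq> 0"
  obtains s where "alternates s 0 p"
proof
  have "lead_coeff p * lead_coeff p > 0" using assms
    by (auto simp: zero_less_mult_iff neq_iff simp flip: leading_coeff_0_iff)
  then show "alternates (lead_coeff p) 0 p"
    unfolding alternates_def
    by (intro exI[of _ "\<lambda>_. degree p"]) simp
qed

text \<open>Descartes' bound: a nonzero \<open>p\<close> starts with no sign change, every factor
  adds one, and \<open>card S\<close> terms allow at most \<open>card S - 1\<close>.\<close>

lemma length_less_card_support: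
  assumes "\<And>x. x \<in> set xs \<Longrightarrow> x > 0" "p \<noteq> 0" "supported_on S (linear_prod xs * p)" "finite S"
  shows "length xs < card S"
proof -
  obtain s where "alternates s 0 p" using alternates_0 assms(2) .
  from alternates_less_card[OF alternates_linear_prod_mult[OF assms(1) this] assms(3,4)]
  show ?thesis by simp
qed

text \<open>Two coefficients of opposite sign give \<open>p\<close> one sign change, so the product
  would have \<open>length xs + 1\<close>, one more than \<open>card S\<close> terms allow.\<close>

lemma nonneg_coeffs_cofactor:
  assumes "\<And>x. x \<in> set xs \<Longrightarrow> x > 0" "supported_on S (linear_prod xs * p)" "finite S"
    "card S = Suc (length xs)"
  shows "nonneg_coeffs p \<or> nonneg_coeffs (- p)"
proof (rule ccontr)
  assume "\<not> ?thesis"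
  then obtain a b where ab: "coeff p a < 0" "coeff p b > 0"
    unfolding nonneg_coeffs_def by (auto simp: not_le)
  then have "a \<noteq> b" by auto
  then have "\<exists>s. alternates s 1 p"
  proof (cases "a < b")
    case True
    with ab show ?thesis unfolding alternates_def
      by (intro exI[of _ "-1"] exI[of _ "\<lambda>j. if j = 0 then a else b"]) (auto simp: le_Suc_eq)
  next
    case False
    with ab \<open>a \<noteq> b\<close> show ?thesis unfolding alternates_def
      by (intro exI[of _ "1"] exI[of _ "\<lambda>j. if j = 0 then b else a"]) (auto simp: le_Suc_eq)
  qed
  then obtain s where "alternates s 1 p" ..
  from alternates_less_card[OF alternates_linear_prod_mult[OF assms(1) this] assms(2,3)]
  show False using assms(4) by simp
qed

section \<open>Polynomials with prescribed positive zeros and exponents\<close>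

lemma nonneg_coeffs_poly_pos:
  assumes "nonneg_coeffs p" "p \<noteq> 0" "x > 0"
  shows "poly p x > 0"
proof -
  have "lead_coeff p > 0"
    using assms unfolding nonneg_coeffs_def by (metis leading_coeff_0_iff order_less_le)
  then have "0 < lead_coeff p * x ^ degree p" using assms by simp
  also have "\<dots> \<le> (\<Sum>i\<le>degree p. coeff p i * x ^ i)"
    using assms unfolding nonneg_coeffs_def by (intro member_le_sum) auto
  finally show ?thesis by (simp add: poly_altdef)
qed

lemma linear_dvdE:
  fixes x :: real
  assumes "poly p x = 0"
  obtains q where "p = [:x, -1:] * q"
proof -
  obtain q where "p = [:-x, 1:] * q"
    using assms by (auto simp: poly_eq_0_iff_dvd)
  then have "p = [:x, -1:] * (- q)" by simp
  then show ?thesis by (rule that)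
qed

text \<open>Induction on the zeros. Leaving out either of two exponents gives two polynomials with
  the remaining zeros; their combination that vanishes at \<open>x\<close> acquires the new
  factor.\<close>

lemma cofactor_exists:
  assumes "\<And>x. x \<in> set xs \<Longrightarrow> x > 0" "finite S" "card S = Suc (length xs)"
  shows "\<exists>p. p \<noteq> 0 \<and> nonneg_coeffs p \<and> supported_on S (linear_prod xs * p)"
  using assms
proof (induction xs arbitrary: S)
  case Nil
  then obtain a where "S = {a}" by (auto simp: card_Suc_eq)
  then show ?case
    by (intro exI[of _ "monom 1 a"]) (auto simp: supported_on_def nonneg_coeffs_def)
next
  case (Cons x xs)
  then obtain a b where ab: "a \<in> S" "b \<in> S" "a \<noteq> b"
    by (metis card_le_Suc0_iff_eq length_Cons not_less_eq_eq Suc_le_mono le0)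
  let ?G = "linear_prod xs"
  have pos: "\<And>x. x \<in> set xs \<Longrightarrow> x > 0" and x: "x > 0" using Cons.prems by auto
  have "\<exists>p. p \<noteq> 0 \<and> nonneg_coeffs p \<and> supported_on (S - {c}) (?G * p)" if "c \<in> S" for c
    using Cons that by simp
  with ab obtain p1 p2 where
    p1: "p1 \<noteq> 0" "nonneg_coeffs p1" "supported_on (S - {a}) (?G * p1)" and
    p2: "p2 \<noteq> 0" "nonneg_coeffs p2" "supported_on (S - {b}) (?G * p2)" by metis
  have pos1: "poly p1 x > 0" and pos2: "poly p2 x > 0"
    using nonneg_coeffs_poly_pos p1 p2 x by auto
  define r where "r = smult (poly p1 x) p2 - smult (poly p2 x) p1"
  obtain q where q: "r = [:x, -1:] * q"
    by (rule linear_dvdE[of r x]) (simp add: r_def)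
  have coeff_r: "coeff (?G * r) k = poly p1 x * coeff (?G * p2) k - poly p2 x * coeff (?G * p1) k" for k
    by (simp add: r_def right_diff_distrib)
  \<comment> \<open>If \<open>r\<close> were 0, the two products would be proportional and both
    would lack \<open>a\<close> and \<open>b\<close>. Only \<open>length xs\<close> exponents would
    remain, too few for \<open>length xs\<close> positive zeros.\<close>
  have "r \<noteq> 0"
  proof
    assume "r = 0"
    with coeff_r have "poly p1 x * coeff (?G * p2) k = poly p2 x * coeff (?G * p1) k" for k
      by simp
    then have "supported_on (S - {a} - {b}) (?G * p1)"
      using pos1 pos2 p1(3) p2(3) unfolding supported_on_def
      by (metis Diff_iff mult_eq_0_iff less_irrefl)
    then have "length xs < card (S - {a} - {b})"
      using length_less_card_support pos p1(1) Cons.prems(2) by blast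
    then show False using Cons.prems ab by simp
  qed
  have supp: "supported_on S (linear_prod (x # xs) * q)"
  proof -
    have "linear_prod (x # xs) * q = ?G * r" by (simp only: q linear_prod_Cons mult_ac)
    moreover have "supported_on S (?G * r)"
      using p1(3) p2(3) coeff_r unfolding supported_on_def by force
    ultimately show ?thesis by simp
  qed
  \<comment> \<open>The coefficients of \<open>q\<close> have constant but unknown sign, so
    \<open>- q\<close> must qualify as well.\<close>
  then have "supported_on S (linear_prod (x # xs) * (- q))"
    unfolding supported_on_def by (simp del: linear_prod_Cons)
  moreover have "q \<noteq> 0" using \<open>r \<noteq> 0\<close> q by auto
  moreover have "nonneg_coeffs q \<or> nonneg_coeffs (- q)"
    using nonneg_coeffs_cofactor[OF Cons.prems(1) supp] Cons.prems(2,3) by simp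
  ultimately show ?case using supp neg_equal_0_iff_equal by metis
qed

section \<open>Zeros of nonnegative polynomials\<close>

lemma poly_nonneg_right:
  fixes p :: "real poly"
  assumes "a < b" "\<And>t. a < t \<Longrightarrow> t < b \<Longrightarrow> poly p t \<ge> 0"
  shows "poly p a \<ge> 0"
proof (rule tendsto_lowerbound)
  show "(poly p \<longlongrightarrow> poly p a) (at_right a)"
    using poly_isCont[of a p] by (simp add: isCont_def filterlim_at_split)
  show "\<forall>\<^sub>F t in at_right a. 0 \<le> poly p t"
    using assms by (auto simp: eventually_at_right)
qed simp

lemma poly_nonneg_left:
  fixes p :: "real poly"
  assumes "a < b" "\<And>t. a < t \<Longrightarrow> t < b \<Longrightarrow> poly p t \<ge> 0"
  shows "poly p b \<ge> 0"
proof (rule tendsto_lowerbound)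
  show "(poly p \<longlongrightarrow> poly p b) (at_left b)"
    using poly_isCont[of b p] by (simp add: isCont_def filterlim_at_split)
  show "\<forall>\<^sub>F t in at_left b. 0 \<le> poly p t"
    using assms by (auto simp: eventually_at_left)
qed simp

text \<open>At an interior zero the cofactor of \<open>x - t\<close> is \<ge> 0 to the left and
  \<le> 0 to the right, so by continuity it vanishes at \<open>x\<close> too.\<close>

lemma double_zero_factor:
  fixes p :: "real poly"
  assumes nonneg: "\<And>t. t \<in> I \<Longrightarrow> poly p t \<ge> 0" and ab: "{a..b} \<subseteq> I" "a < x" "x < b"
    and zero: "poly p x = 0"
  obtains q where "p = [:x, -1:] ^ 2 * q" "\<And>t. t \<in> I \<Longrightarrow> poly q t \<ge> 0"
proof -
  obtain r where r: "p = [:x, -1:] * r" using linear_dvdE zero by blast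
  have p: "poly p t = (x - t) * poly r t" for t by (simp add: r algebra_simps)
  have "poly r x \<ge> 0"
  proof (rule poly_nonneg_left[OF ab(2)])
    show "poly r t \<ge> 0" if "a < t" "t < x" for t
      using nonneg[of t] subsetD[OF ab(1), of t] ab(2,3) p[of t] that by (simp add: zero_le_mult_iff)
  qed
  moreover have "poly (- r) x \<ge> 0"
  proof (rule poly_nonneg_right[OF ab(3)])
    show "poly (- r) t \<ge> 0" if "x < t" "t < b" for t
      using nonneg[of t] subsetD[OF ab(1), of t] ab(2,3) p[of t] that by (simp add: zero_le_mult_iff)
  qed
  ultimately have "poly r x = 0" by simp
  then obtain q where q: "r = [:x, -1:] * q" using linear_dvdE by blast
  have "p = [:x, -1:] ^ 2 * q" by (simp add: r q power2_eq_square del: mult_pCons_left)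
  moreover have p2: "poly p t = (x - t)\<^sup>2 * poly q t" for t
    by (simp add: r q power2_eq_square algebra_simps)
  have q_pos: "poly q t \<ge> 0" if "t \<in> I" "t \<noteq> x" for t
    using nonneg[OF that(1)] that(2) p2[of t] by (simp add: zero_le_mult_iff)
  have "poly q x \<ge> 0"
    by (rule poly_nonneg_right[OF ab(3)]) (use q_pos subsetD[OF ab(1)] ab(2) in simp)
  with q_pos have "\<And>t. t \<in> I \<Longrightarrow> poly q t \<ge> 0" by blast
  ultimately show ?thesis using that by blast
qed

text \<open>Since \<open>G\<close> does not vanish at 0, the whole order of \<open>G * F\<close> at
  0 comes from \<open>F\<close>.\<close>

lemma monom_dvd_cofactor:
  fixes F G :: "real poly"
  assumes "poly G 0 \<noteq> 0" "F \<noteq> 0" "supported_on S (G * F)" "\<And>k. k \<in> S \<Longrightarrow> a \<le> k"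
  shows "monom 1 a dvd F"
proof -
  have "monom 1 a dvd G * F"
    using assms(3,4) unfolding monom_1_dvd_iff' supported_on_def by (meson not_le)
  moreover have "G \<noteq> 0" using assms by auto
  ultimately have "a \<le> order 0 (G * F)" using assms by (simp add: monom_1_dvd_iff)
  also have "\<dots> = order 0 F"
    using assms \<open>G \<noteq> 0\<close> by (simp add: order_mult order_0I)
  finally show ?thesis using assms by (simp add: monom_1_dvd_iff)
qed

section \<open>The largest multiple that can be subtracted\<close>

text \<open>Here \<open>1 / l\<close> is the maximum of \<open>H / F\<close>, attained at
  \<open>x\<close>; the point \<open>u\<close> makes it positive. The bound at \<open>u\<close>
  serves when \<open>{0..c}\<close> is a truncated half-line.\<close>

lemma peel_compact:
  fixes F H :: "real poly"
  assumes F: "\<And>t. t \<in> {0..c} \<Longrightarrow> poly F t > 0" and u: "u \<in> {0..c}" "poly H u > 0"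
  obtains l x where "l > 0" "x \<in> {0..c}" "poly F x = l * poly H x" "poly H u / poly F u \<le> 1 / l"
    "\<And>t. t \<in> {0..c} \<Longrightarrow> l * poly H t \<le> poly F t"
proof -
  have "continuous_on {0..c} (\<lambda>t. poly H t / poly F t)"
    using F by (intro continuous_intros) force+
  then obtain x where x: "x \<in> {0..c}"
    and max: "\<And>t. t \<in> {0..c} \<Longrightarrow> poly H t / poly F t \<le> poly H x / poly F x"
    using continuous_attains_sup[of "{0..c}" "\<lambda>t. poly H t / poly F t"] u(1) by auto
  have "0 < poly H u / poly F u" using u F by simp
  also have "\<dots> \<le> poly H x / poly F x" using max u by simp
  finally have Hx: "poly H x > 0" using F[OF x] by (simp add: zero_less_divide_iff)
  show ?thesis
  proof
    show "poly F x / poly H x > 0" using Hx F[OF x] by simp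
    show "poly F x = poly F x / poly H x * poly H x" using Hx by simp
    show "poly H u / poly F u \<le> 1 / (poly F x / poly H x)" using max[OF u(1)] by simp
    show "poly F x / poly H x * poly H t \<le> poly F t" if "t \<in> {0..c}" for t
      using max[OF that] F[OF x] F[OF that] Hx by (simp add: field_simps)
  qed (use x in simp)
qed

text \<open>On the half-line the quotient \<open>H/F\<close> either attains its supremum or is bounded by its limit
  at infinity, which is the quotient of the coefficients in degree \<open>degree F\<close>.\<close>

lemma peel_half_line:
  fixes F H :: "real poly"
  assumes F: "\<And>t. t \<ge> 0 \<Longrightarrow> poly F t > 0" and u: "u \<ge> 0" "poly H u > 0"
    and deg: "degree H \<le> degree F"
  obtains l where "l > 0" "\<And>t. t \<ge> 0 \<Longrightarrow> l * poly H t \<le> poly F t"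
    "(\<exists>x\<ge>0. poly F x = l * poly H x) \<or> coeff (F - smult l H) (degree F) = 0"
proof -
  define L where "L = coeff H (degree F) / lead_coeff F"
  have lc: "lead_coeff F > 0"
  proof (rule ccontr)
    have "F \<noteq> 0" using F[of 0] by auto
    moreover assume "\<not> ?thesis"
    ultimately have "lead_coeff (- F) > 0"
      by (simp add: not_less order_less_le)
    from poly_pinfty_gt_lc[OF this] obtain n where "\<forall>t\<ge>n. poly (- F) t \<ge> lead_coeff (- F)" by auto
    then have "poly (- F) (max n 0) > 0" using \<open>lead_coeff (- F) > 0\<close>
      by (metis max.cobounded1 less_le_trans)
    then show False using F[of "max n 0"] by simp
  qed
  show ?thesis
  \<comment> \<open>A value above the limit \<open>L\<close> forces the supremum to be attained.
    Comparing with 0 as well provides the positivity that \<open>peel_compact\<close> asks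
    for.\<close>
  proof (cases "\<exists>v\<ge>0. poly H v / poly F v > max L 0")
    case True
    then obtain v where v: "v \<ge> 0" "poly H v / poly F v > L" "poly H v / poly F v > 0" by auto
    define w where "w = poly H v / poly F v"
    \<comment> \<open>As \<open>w > L\<close>, the leading coefficient of \<open>R\<close> is
      positive, so \<open>H / F < w\<close> beyond some \<open>T\<close>, and the maximum on
      \<open>{0..max v T}\<close> is global.\<close>
    define R where "R = smult w F - H"
    have "coeff R (degree F) > 0" using v lc by (simp add: R_def L_def w_def field_simps)
    moreover have "degree R \<le> degree F"
      unfolding R_def using deg by (intro degree_diff_le) auto
    ultimately have "lead_coeff R > 0" using le_degree by (metis less_irrefl order_antisym)
    from poly_pinfty_gt_lc[OF this] obtain T where T: "\<And>t. t \<ge> T \<Longrightarrow> poly R t > 0"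
      using \<open>lead_coeff R > 0\<close> by (metis less_le_trans)
    have "poly H v > 0" using v(3) F[OF v(1)] by (simp add: zero_less_divide_iff)
    then obtain l x where l: "l > 0" "x \<in> {0..max v T}" "poly F x = l * poly H x" "w \<le> 1 / l"
      "\<And>t. t \<in> {0..max v T} \<Longrightarrow> l * poly H t \<le> poly F t"
      using peel_compact[of "max v T" F v H] F v unfolding w_def by (metis atLeastAtMost_iff max.cobounded1)
    have "l * poly H t \<le> poly F t" if "t \<ge> 0" for t
    proof (cases "t \<le> max v T")
      case False
      then have "poly H t \<le> w * poly F t" using less_imp_le[OF T[of t]] by (simp add: R_def)
      also have "\<dots> \<le> 1 / l * poly F t" using l(4) F[OF that] by (intro mult_right_mono) auto
      finally show ?thesis using l(1) by (simp add: field_simps)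
    qed (use l(5) that in simp)
    then show ?thesis using that[of l] l by auto
  next
    case False
    then have le: "poly H t / poly F t \<le> max L 0" if "t \<ge> 0" for t using that by force
    have "0 < poly H u / poly F u" using u F by simp
    \<comment> \<open>The positive value at \<open>u\<close> rules out \<open>L \<le> 0\<close>.
      With \<open>l = 1 / L\<close> the coefficients in degree \<open>degree F\<close>
      cancel.\<close>
    with le[of u] u have L: "L > 0" by linarith
    show ?thesis
    proof
      show "1 / L > 0" using L by simp
      show "1 / L * poly H t \<le> poly F t" if "t \<ge> 0" for t
        using le[OF that] L F[OF that] by (simp add: field_simps)
      show "(\<exists>x\<ge>0. poly F x = 1 / L * poly H x) \<or> coeff (F - smult (1 / L) H) (degree F) = 0"
        using L lc by (auto simp: L_def)
    qed
  qed
qed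

section \<open>Adding summands to a representation\<close>

lemma has_representation_a_0 [simp]: "has_representation_a d M 0"
  unfolding has_representation_a_def by (intro exI[of _ 0]) auto

lemma has_representation_b_0 [simp]: "has_representation_b d M 0"
  unfolding has_representation_b_def by (intro exI[of _ 0]) auto

lemma has_representation_a_add_square:
  assumes "has_representation_a d M f" "degree g0 \<le> d" "degree (g0 ^ 2 * p0) \<le> M" "nonneg_coeffs p0"
  shows "has_representation_a d M (f + g0 ^ 2 * p0)"
proof -
  obtain r s :: nat and g p h q :: "nat \<Rightarrow> real poly" where *:
      "f = (\<Sum>i<r. g i ^ 2 * p i) + [:1, -1:] * (\<Sum>j<s. h j ^ 2 * q j)"
      "\<forall>i<r. degree (g i) \<le> d \<and> degree (g i ^ 2 * p i) \<le> M \<and> nonneg_coeffs (p i)"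
      "\<forall>j<s. degree (h j) \<le> d \<and> degree ([:1, -1:] * (h j ^ 2 * q j)) \<le> M \<and> nonneg_coeffs (q j)"
    using assms(1) unfolding has_representation_a_def by (elim exE conjE) (rule that)
  show ?thesis
    unfolding has_representation_a_def
    by (rule exI[of _ "Suc r"], rule exI[of _ s], rule exI[of _ "g(r := g0)"],
        rule exI[of _ "p(r := p0)"], rule exI[of _ h], rule exI[of _ q])
      (use * assms in \<open>auto simp: less_Suc_eq simp del: mult_pCons_left\<close>)
qed

lemma has_representation_a_add_weighted_square:
  assumes "has_representation_a d M f" "degree h0 \<le> d" "degree ([:1, -1:] * (h0 ^ 2 * q0)) \<le> M"
    "nonneg_coeffs q0"
  shows "has_representation_a d M (f + [:1, -1:] * (h0 ^ 2 * q0))"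
proof -
  obtain r s :: nat and g p h q :: "nat \<Rightarrow> real poly" where *:
      "f = (\<Sum>i<r. g i ^ 2 * p i) + [:1, -1:] * (\<Sum>j<s. h j ^ 2 * q j)"
      "\<forall>i<r. degree (g i) \<le> d \<and> degree (g i ^ 2 * p i) \<le> M \<and> nonneg_coeffs (p i)"
      "\<forall>j<s. degree (h j) \<le> d \<and> degree ([:1, -1:] * (h j ^ 2 * q j)) \<le> M \<and> nonneg_coeffs (q j)"
    using assms(1) unfolding has_representation_a_def by (elim exE conjE) (rule that)
  show ?thesis
    unfolding has_representation_a_def
    by (rule exI[of _ r], rule exI[of _ "Suc s"], rule exI[of _ g],
        rule exI[of _ p], rule exI[of _ "h(s := h0)"], rule exI[of _ "q(s := q0)"])
      (use * assms in \<open>auto simp: less_Suc_eq distrib_left simp del: mult_pCons_left\<close>)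
qed

lemma has_representation_b_add_square:
  assumes "has_representation_b d M f" "degree g0 \<le> d" "degree (g0 ^ 2 * p0) \<le> M" "nonneg_coeffs p0"
  shows "has_representation_b d M (f + g0 ^ 2 * p0)"
proof -
  obtain r :: nat and g p :: "nat \<Rightarrow> real poly" where *: "f = (\<Sum>i<r. g i ^ 2 * p i)"
      "\<forall>i<r. degree (g i) \<le> d \<and> degree (g i ^ 2 * p i) \<le> M \<and> nonneg_coeffs (p i)"
    using assms(1) unfolding has_representation_b_def by (elim exE conjE) (rule that)
  show ?thesis
    unfolding has_representation_b_def
    by (rule exI[of _ "Suc r"], rule exI[of _ "g(r := g0)"], rule exI[of _ "p(r := p0)"])
      (use * assms in \<open>auto simp: less_Suc_eq\<close>)
qed

lemma nonneg_coeffs_smult: "nonneg_coeffs p \<Longrightarrow> c \<ge> 0 \<Longrightarrow> nonneg_coeffs (smult c p)"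
  by (simp add: nonneg_coeffs_def)

lemma poly_monom_cofactor_nonneg:
  fixes q :: "real poly"
  assumes "c > 0" "\<And>t. t \<in> {0<..c} \<Longrightarrow> poly (monom 1 a * q) t \<ge> 0"
  shows "t \<in> {0..c} \<Longrightarrow> poly q t \<ge> 0"
proof -
  have *: "poly q t \<ge> 0" if "t \<in> {0<..c}" for t
    using assms(2)[OF that] zero_less_power[of t a] that
    by (simp add: poly_monom zero_le_mult_iff del: zero_less_power)
  moreover have "poly q 0 \<ge> 0" by (rule poly_nonneg_right[OF assms(1)]) (use * in auto)
  ultimately show "t \<in> {0..c} \<Longrightarrow> poly q t \<ge> 0" by (cases "t = 0") auto
qed

text \<open>Used with \<open>a\<close> the least exponent: a zero of the cofactor at 0 removes
  \<open>a\<close> from the support.\<close>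

lemma coeff_monom_mult_zero:
  fixes p q :: "real poly"
  assumes "poly q 0 = 0"
  shows "coeff (p * (monom 1 a * q)) a = 0"
proof -
  have "coeff (p * q) 0 = 0" using assms by (simp flip: poly_0_coeff_0)
  moreover have "p * (monom 1 a * q) = monom 1 a * (p * q)" by (simp only: mult_ac)
  ultimately show ?thesis by (simp only: coeff_monom_mult) simp
qed

section \<open>The compact interval\<close>

text \<open>The induction carries known double zeros \<open>xs\<close>, a known power
  \<open>e\<close> of \<open>1 - t\<close> and the nonnegative cofactor \<open>F\<close>. The bounds
  \<open>d\<close> and \<open>M\<close> stay fixed while \<open>S\<close> shrinks; losing an
  exponent or gaining a zero lowers the measure.\<close>

lemma representation_a:
  assumes "finite S" "supported_on S f" "f = linear_prod xs ^ 2 * [:1, -1:] ^ e * F"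
    "\<And>t. t \<in> {0..1} \<Longrightarrow> poly F t \<ge> 0" "\<And>x. x \<in> set xs \<Longrightarrow> x > 0"
    "(card S - 1) div 2 \<le> d" "\<And>k. k \<in> S \<Longrightarrow> k \<le> M"
  shows "has_representation_a d M f"
  using assms
proof (induction "2 * card S - (2 * length xs + e)" arbitrary: S f xs e F rule: less_induct)
  case less
  show ?case
  proof (cases "f = 0")
    case False
    define G where "G = linear_prod xs ^ 2 * [:1, -1:] ^ e"
    have G: "G = linear_prod (xs @ xs @ replicate e 1)"
      by (simp add: G_def power2_eq_square mult.assoc)
    have f: "f = G * F" using less.prems(3) by (simp add: G_def)
    have "F \<noteq> 0" using f False by auto
    have pos: "\<And>x. x \<in> set (xs @ xs @ replicate e 1) \<Longrightarrow> x > 0" using less.prems(5) by auto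
    \<comment> \<open>Besides bounding the known zeros, this keeps the truncated difference in the
      measure positive, so that it really decreases.\<close>
    have N: "2 * length xs + e < card S"
      using length_less_card_support[where S = S and xs = "xs @ xs @ replicate e 1", OF pos \<open>F \<noteq> 0\<close>]
        less.prems(1,2) f G by simp
    then have "S \<noteq> {}" by auto
    define a where "a = Min S"
    have a: "a \<in> S" "\<And>k. k \<in> S \<Longrightarrow> a \<le> k"
      using less.prems(1) \<open>S \<noteq> {}\<close> by (auto simp: a_def)
    have G0: "poly G 0 \<noteq> 0" using poly_linear_prod_0[of "xs @ xs @ replicate e 1", OF pos] G by simp
    \<comment> \<open>A zero of \<open>F1\<close> gives access to the induction hypothesis: at 0 the
      exponent \<open>a\<close> is lost, at the endpoint 1 a single factor \<open>1 - t\<close> is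
      gained, and inside a double zero.\<close>
    have step: "has_representation_a d M f1"
      if f1: "supported_on S f1" "f1 = G * (monom 1 a * F1)"
        and nonneg: "\<And>t. t \<in> {0..1} \<Longrightarrow> poly F1 t \<ge> 0"
        and x: "x \<in> {0..1}" "poly F1 x = 0" for f1 F1 x
    proof -
      have nonneg': "poly (monom 1 a * F1) t \<ge> 0" if "t \<in> {0..1}" for t
        using nonneg[OF that] that by (simp add: poly_monom)
      consider "x = 0" | "x = 1" | "0 < x" "x < 1" using x by force
      then show ?thesis
      proof cases
        case 1
        then have "supported_on (S - {a}) f1"
          using coeff_monom_mult_zero[of F1 G a] x f1 by (intro supported_on_remove) simp_all
        then show ?thesis
          using N a less.prems f1(2) nonneg'
          by (intro less.hyps[where S = "S - {a}" and xs = xs and e = e and F = "monom 1 a * F1"])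
            (auto simp: G_def card_Diff_singleton simp del: mult_pCons_left)
      next
        case 2
        then obtain q where q: "F1 = [:1, -1:] * q" using x linear_dvdE by blast
        have q_pos: "poly q t \<ge> 0" if "t \<in> {0..<1}" for t
        proof -
          have "poly F1 t = (1 - t) * poly q t" by (simp add: q algebra_simps)
          then show ?thesis using nonneg[of t] that by (simp add: zero_le_mult_iff)
        qed
        then have "poly q 1 \<ge> 0" using poly_nonneg_left[of 0 1 q] by simp
        with q_pos have "poly q t \<ge> 0" if "t \<in> {0..1}" for t
          using that by (cases "t = 1") auto
        moreover have "f1 = linear_prod xs ^ 2 * [:1, -1:] ^ Suc e * (monom 1 a * q)"
          unfolding f1 G_def q by (simp only: power_Suc mult_ac)
        ultimately show ?thesis
          using N less.prems f1
          by (intro less.hyps[where S = S and xs = xs and e = "Suc e" and F = "monom 1 a * q"])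
            (auto simp: poly_monom)
      next
        case 3
        then obtain q where q: "monom 1 a * F1 = [:x, -1:] ^ 2 * q"
            "\<And>t. t \<in> {0..1} \<Longrightarrow> poly q t \<ge> 0"
          using double_zero_factor[of "{0..1}" "monom 1 a * F1" 0 1 x] nonneg' x by auto
        have "f1 = linear_prod (x # xs) ^ 2 * [:1, -1:] ^ e * q"
          unfolding f1 G_def q(1) linear_prod_Cons by (simp only: power_mult_distrib mult_ac)
        then show ?thesis
          using N less.prems f1(1) q(2) 3
          by (intro less.hyps[where S = S and xs = "x # xs" and e = e and F = q]) auto
      qed
    qed
    obtain F1 where F1: "F = monom 1 a * F1"
      using monom_dvd_cofactor[OF G0 \<open>F \<noteq> 0\<close> _ a(2)] less.prems(2) f by (auto elim: dvdE)
    have F1_nonneg: "poly F1 t \<ge> 0" if "t \<in> {0..1}" for t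
      using poly_monom_cofactor_nonneg[of 1 a F1 t] less.prems(4) F1 that by auto
    show ?thesis
    proof (cases "\<exists>x\<in>{0..1}. poly F1 x = 0")
      case True
      then show ?thesis using step[of f F1] less.prems(2) f F1 F1_nonneg by blast
    next
      case False
      with F1_nonneg have F1_pos: "\<And>t. t \<in> {0..1} \<Longrightarrow> poly F1 t > 0" by force
      \<comment> \<open>Zeros at 1 fill the total up to \<open>card S - 1\<close>, the number
        required by \<open>cofactor_exists\<close>.\<close>
      define e' where "e' = card S - 1 - 2 * length xs"
      have e': "e \<le> e'" "card S = Suc (2 * length xs + e')"
        using N by (auto simp: e'_def)
      define G' where "G' = linear_prod xs ^ 2 * [:1, -1:] ^ e'"
      have G': "G' = linear_prod (xs @ xs @ replicate e' 1)"
        by (simp add: G'_def power2_eq_square mult.assoc)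
      have pos': "\<And>x. x \<in> set (xs @ xs @ replicate e' 1) \<Longrightarrow> x > 0" using less.prems(5) by auto
      obtain p where p: "p \<noteq> 0" "nonneg_coeffs p" "supported_on S (G' * p)"
        using cofactor_exists[of "xs @ xs @ replicate e' 1", OF pos' less.prems(1)] e'(2) N G' by auto
      have "poly G' 0 \<noteq> 0" using poly_linear_prod_0[of "xs @ xs @ replicate e' 1", OF pos'] G' by simp
      then obtain P where P: "p = monom 1 a * P"
        using monom_dvd_cofactor[OF _ p(1,3) a(2)] by (auto elim: dvdE)
      \<comment> \<open>This is \<open>G' * p\<close> divided by \<open>G * monom 1 a\<close>, the
        counterpart of \<open>F1\<close>.\<close>
      define H where "H = [:1, -1:] ^ (e' - e) * P"
      have G'p: "G' * p = G * (monom 1 a * H)"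
      proof -
        have "[:1, -1::real:] ^ e' = [:1, -1:] ^ e * [:1, -1:] ^ (e' - e)"
          using e'(1) by (simp flip: power_add)
        then show ?thesis unfolding G'_def G_def H_def P by (simp only: mult_ac)
      qed
      \<comment> \<open>An interior point is taken because \<open>H\<close> vanishes at 1 when
        \<open>e < e'\<close>.\<close>
      have "poly p (1/2) > 0" using nonneg_coeffs_poly_pos[OF p(2,1)] by simp
      then have "poly H (1/2) > 0"
        by (simp add: P H_def poly_monom zero_less_mult_iff)
      moreover have "(1/2::real) \<in> {0..1}" by simp
      ultimately obtain l x where l: "l > 0" "x \<in> {0..1}" "poly F1 x = l * poly H x"
        "\<And>t. t \<in> {0..1} \<Longrightarrow> l * poly H t \<le> poly F1 t"
        using peel_compact[OF F1_pos] by metis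
      have "has_representation_a d M (f - smult l (G' * p))"
      proof (rule step)
        show "supported_on S (f - smult l (G' * p))"
          using supported_on_diff_smult less.prems(2) p(3) by blast
        show "f - smult l (G' * p) = G * (monom 1 a * (F1 - smult l H))"
          by (simp add: f F1 G'p right_diff_distrib)
      qed (use l in auto)
      then have rep: "has_representation_a d M (f - G' * smult l p)" by simp
      have nn: "nonneg_coeffs (smult l p)" using p(2) l(1) by (simp add: nonneg_coeffs_smult)
      have deg: "degree (G' * smult l p) \<le> M"
        using supported_on_degree_le[OF p(3) less.prems(7)] l(1) by simp
      \<comment> \<open>Half of the zeros of \<open>G'\<close>, so the degree is
        \<open>(card S - 1) div 2\<close>. The parity of \<open>e'\<close> decides whether a factor
        \<open>1 - t\<close> is left over.\<close>
      define g where "g = linear_prod xs * [:1, -1:] ^ (e' div 2)"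
      have "degree g = length xs + e' div 2"
        using degree_linear_prod[of "xs @ replicate (e' div 2) 1"] by (simp add: g_def)
      then have deg_g: "degree g \<le> d" using less.prems(6) e'(2) by simp
      show ?thesis
      proof (cases "even e'")
        case True
        then have "e' div 2 * 2 = e'" by simp
        then have "G' = g ^ 2"
          unfolding G'_def g_def power_mult_distrib power_mult[symmetric] by simp
        then show ?thesis
          using has_representation_a_add_square[OF rep deg_g, of "smult l p"] nn deg by simp
      next
        case False
        then have "Suc (e' div 2 * 2) = e'" by presburger
        then have "G' = [:1, -1:] * g ^ 2"
          unfolding G'_def g_def power_mult_distrib power_mult[symmetric]
          by (metis mult.left_commute power_Suc)
        then have G'l: "G' * smult l p = [:1, -1:] * (g ^ 2 * smult l p)" by (simp only: mult.assoc)
        show ?thesis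
          using has_representation_a_add_weighted_square[OF rep deg_g _ nn] deg
          unfolding G'l by (simp del: mult_pCons_left)
      qed
    qed
  qed simp
qed

section \<open>The half-line\<close>

text \<open>The same induction; every positive zero is now interior, hence double, so no separate
  power of \<open>1 - t\<close> is carried.\<close>

lemma representation_b:
  assumes "finite S" "supported_on S f" "f = linear_prod xs ^ 2 * F"
    "\<And>t. t \<in> {0..} \<Longrightarrow> poly F t \<ge> 0" "\<And>x. x \<in> set xs \<Longrightarrow> x > 0"
    "(card S - 1) div 2 \<le> d" "\<And>k. k \<in> S \<Longrightarrow> k \<le> M"
  shows "has_representation_b d M f"
  using assms
proof (induction "2 * card S - 2 * length xs" arbitrary: S f xs F rule: less_induct)
  case less
  show ?case
  proof (cases "f = 0")
    case False
    define G where "G = linear_prod xs ^ 2"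
    have G: "G = linear_prod (xs @ xs)"
      by (simp add: G_def power2_eq_square)
    have f: "f = G * F" using less.prems(3) by (simp add: G_def)
    have "F \<noteq> 0" using f False by auto
    have pos: "\<And>x. x \<in> set (xs @ xs) \<Longrightarrow> x > 0" using less.prems(5) by auto
    have N: "2 * length xs < card S"
      using length_less_card_support[where S = S and xs = "xs @ xs", OF pos \<open>F \<noteq> 0\<close>]
        less.prems(1,2) f G by simp
    then have "S \<noteq> {}" by auto
    define a where "a = Min S"
    have a: "a \<in> S" "\<And>k. k \<in> S \<Longrightarrow> a \<le> k"
      using less.prems(1) \<open>S \<noteq> {}\<close> by (auto simp: a_def)
    define D where "D = Max S"
    have D: "D \<in> S" "\<And>k. k \<in> S \<Longrightarrow> k \<le> D"
      using less.prems(1) \<open>S \<noteq> {}\<close> by (auto simp: D_def)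
    have G0: "poly G 0 \<noteq> 0" using poly_linear_prod_0[of "xs @ xs", OF pos] G by simp
    then have "G \<noteq> 0" by auto
    \<comment> \<open>Losing the highest exponent \<open>D\<close> takes the place of a zero when
      the extremal ratio is reached only at infinity.\<close>
    have step: "has_representation_b d M f1"
      if f1: "supported_on S f1" "f1 = G * (monom 1 a * F1)"
        and nonneg: "\<And>t. t \<in> {0..} \<Longrightarrow> poly F1 t \<ge> 0"
        and zero: "(\<exists>x\<ge>0. poly F1 x = 0) \<or> coeff f1 D = 0" for f1 F1
    proof -
      have nonneg': "poly (monom 1 a * F1) t \<ge> 0" if "t \<in> {0..}" for t
        using nonneg[OF that] that by (simp add: poly_monom)
      have drop: ?thesis if "b \<in> S" "coeff f1 b = 0" for b
      proof -
        have "supported_on (S - {b}) f1" using supported_on_remove f1(1) that(2) .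
        then show ?thesis
          using N that(1) less.prems f1(2) nonneg'
          by (intro less.hyps[where S = "S - {b}" and xs = xs and F = "monom 1 a * F1"])
            (auto simp: G_def card_Diff_singleton)
      qed
      consider "poly F1 0 = 0" | "coeff f1 D = 0" | x where "0 < x" "poly F1 x = 0"
        using zero by force
      then show ?thesis
      proof cases
        case 1
        then show ?thesis using coeff_monom_mult_zero[of F1 G a] f1 a(1) drop by simp
      next
        case 2
        then show ?thesis using D(1) drop by simp
      next
        case 3
        then obtain q where q: "monom 1 a * F1 = [:x, -1:] ^ 2 * q"
            "\<And>t. t \<in> {0..} \<Longrightarrow> poly q t \<ge> 0"
          using double_zero_factor[of "{0..}" "monom 1 a * F1" 0 "x + 1" x] nonneg' by auto
        have "f1 = linear_prod (x # xs) ^ 2 * q"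
          unfolding f1 G_def q(1) linear_prod_Cons by (simp only: power_mult_distrib mult_ac)
        then show ?thesis
          using N less.prems f1(1) q(2) 3
          by (intro less.hyps[where S = S and xs = "x # xs" and F = q]) auto
      qed
    qed
    obtain F1 where F1: "F = monom 1 a * F1"
      using monom_dvd_cofactor[OF G0 \<open>F \<noteq> 0\<close> _ a(2)] less.prems(2) f by (auto elim: dvdE)
    have F1_nonneg: "poly F1 t \<ge> 0" if "t \<in> {0..}" for t
      using poly_monom_cofactor_nonneg[of "t + 1" a F1 t] less.prems(4) F1 that by auto
    show ?thesis
    proof (cases "(\<exists>x\<ge>0. poly F1 x = 0) \<or> coeff f D = 0")
      case True
      then show ?thesis using step[of f F1] less.prems(2) f F1 F1_nonneg by blast
    next
      case False
      with F1_nonneg have F1_pos: "poly F1 t > 0" if "t \<ge> 0" for t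
        using that by (metis atLeast_iff order_less_le)
      \<comment> \<open>A square needs an even number \<open>2 * k\<close> of zeros, hence
        \<open>2 * k + 1\<close> exponents; for even \<open>card S\<close> one exponent is left
        out.\<close>
      define k where "k = (card S - 1) div 2"
      obtain T where T: "T \<subseteq> S" "card T = Suc (2 * k)"
      proof (rule obtain_subset_with_card_n)
        show "Suc (2 * k) \<le> card S" using N by (simp add: k_def)
      qed
      have "finite T" using T less.prems(1) finite_subset by blast
      have k: "length xs \<le> k" using N by (simp add: k_def)
      define ys where "ys = replicate (k - length xs) 1 @ xs"
      have ys: "\<And>x. x \<in> set (ys @ ys) \<Longrightarrow> x > 0" "length ys = k"
        using less.prems(5) k by (auto simp: ys_def)
      define g where "g = linear_prod ys"
      have g: "g ^ 2 = linear_prod (ys @ ys)" by (simp add: g_def power2_eq_square)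
      obtain p where p: "p \<noteq> 0" "nonneg_coeffs p" "supported_on T (g ^ 2 * p)"
        using cofactor_exists[of "ys @ ys", OF ys(1) \<open>finite T\<close>] T(2) ys(2) g by auto
      then have gp: "supported_on S (g ^ 2 * p)" using T(1) supported_on_mono by blast
      have "poly (g ^ 2) 0 \<noteq> 0" using poly_linear_prod_0[of "ys @ ys", OF ys(1)] g by simp
      then obtain P where P: "p = monom 1 a * P"
        using monom_dvd_cofactor[OF _ p(1) gp a(2)] by (auto elim: dvdE)
      define H where "H = ([:1, -1:] ^ (k - length xs)) ^ 2 * P"
      have gp_H: "g ^ 2 * p = G * (monom 1 a * H)"
        unfolding g_def ys_def G_def H_def P linear_prod_append linear_prod_replicate
        by (simp only: power_mult_distrib mult_ac)
      \<comment> \<open>The point 2 avoids 1, where the padding zeros may make \<open>H\<close>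
        vanish.\<close>
      have "poly p 2 > 0" using nonneg_coeffs_poly_pos[OF p(2,1)] by simp
      then have "poly H 2 > 0" by (simp add: P H_def poly_monom zero_less_mult_iff flip: power_mult)
      then have "H \<noteq> 0" by auto
      have "F1 \<noteq> 0" using \<open>F \<noteq> 0\<close> F1 by auto
      have deg_mult: "degree (G * (monom 1 a * q)) = degree G + a + degree q" if "q \<noteq> 0" for q
        using that \<open>G \<noteq> 0\<close> by (simp add: degree_mult_eq degree_monom_eq)
      \<comment> \<open>The coefficient at \<open>D\<close> is nonzero in this case. This yields
        \<open>degree H \<le> degree F1\<close>, as \<open>peel_half_line\<close> requires.\<close>
      have "degree f = D"
        using False supported_on_degree_le[OF less.prems(2) D(2)] le_degree by (metis order_antisym)
      then have deg_F1: "D = degree G + a + degree F1" using deg_mult \<open>F1 \<noteq> 0\<close> f F1 by metis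
      have "degree (g ^ 2 * p) \<le> D" using supported_on_degree_le[OF gp D(2)] .
      then have "degree H \<le> degree F1"
        unfolding gp_H deg_mult[OF \<open>H \<noteq> 0\<close>] deg_F1 by simp
      then obtain l where l: "l > 0" "\<And>t. t \<ge> 0 \<Longrightarrow> l * poly H t \<le> poly F1 t"
        "(\<exists>x\<ge>0. poly F1 x = l * poly H x) \<or> coeff (F1 - smult l H) (degree F1) = 0"
        using peel_half_line[of F1 2 H] F1_pos \<open>poly H 2 > 0\<close> by auto
      define R where "R = F1 - smult l H"
      have fR: "f - smult l (g ^ 2 * p) = G * (monom 1 a * R)"
        by (simp add: f F1 gp_H R_def right_diff_distrib)
      have "has_representation_b d M (f - smult l (g ^ 2 * p))"
      proof (rule step[OF _ fR])
        show "supported_on S (f - smult l (g ^ 2 * p))"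
          using supported_on_diff_smult less.prems(2) gp by blast
        show "(\<exists>x\<ge>0. poly R x = 0) \<or> coeff (f - smult l (g ^ 2 * p)) D = 0"
        proof (cases "\<exists>x\<ge>0. poly F1 x = l * poly H x")
          \<comment> \<open>Without a point of contact the top coefficient cancels, so the degree of
            the difference falls below \<open>D\<close>.\<close>
          case False
          then have "coeff R (degree F1) = 0" and "R \<noteq> 0" using l(3) by (auto simp: R_def)
          moreover have "degree R \<le> degree F1"
            unfolding R_def using \<open>degree H \<le> degree F1\<close> by (intro degree_diff_le) auto
          ultimately have "degree R < degree F1"
            by (metis leading_coeff_0_iff order_less_le)
          then have "degree (G * (monom 1 a * R)) < D" using deg_mult[OF \<open>R \<noteq> 0\<close>] deg_F1 by simp
          then show ?thesis unfolding fR using coeff_eq_0 by blast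
        qed (auto simp: R_def)
        show "poly R t \<ge> 0" if "t \<in> {0..}" for t using l(2) that by (simp add: R_def)
      qed
      then have rep: "has_representation_b d M (f - g ^ 2 * smult l p)" by simp
      show ?thesis
        using has_representation_b_add_square[OF rep, of g "smult l p"] l(1) p(2)
          supported_on_degree_le[OF gp less.prems(7)] degree_linear_prod[of ys] ys(2) less.prems(6)
        by (simp add: nonneg_coeffs_smult g_def k_def)
    qed
  qed simp
qed

section \<open>From the monomial span to both representations\<close>

lemma monomial_space_supported:
  assumes "f \<in> monomial_space n m"
  shows "supported_on (m ` {..n}) f"
  using assms unfolding monomial_space_def
proof (induction rule: real_poly.span_induct_alt)
  case (step c x y)
  then show ?case by (auto simp: supported_on_def split: if_splits)
qed simp

theorem theorem3p9:
  fixes n :: nat and m :: "nat \<Rightarrow> nat"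
  assumes "\<And>i. i < n \<Longrightarrow> m i > m (Suc i)"
  shows "(\<forall>f \<in> nonneg_on {0..1} (monomial_space n m). has_representation_a (n div 2) (m 0) f) \<and>
         (\<forall>f \<in> nonneg_on {0..} (monomial_space n m). has_representation_b (n div 2) (m 0) f)"
proof -
  have "m i \<le> m 0" if "i \<le> n" for i
    using that by (induction i) (use assms less_imp_le_nat le_trans Suc_le_lessD in \<open>blast+\<close>)
  then have le: "\<And>k. k \<in> m ` {..n} \<Longrightarrow> k \<le> m 0" by auto
  have card: "(card (m ` {..n}) - 1) div 2 \<le> n div 2"
    using card_image_le[of "{..n}" m] by (intro div_le_mono) auto
  show ?thesis
  proof (intro conjI ballI)
    show "has_representation_a (n div 2) (m 0) f" if "f \<in> nonneg_on {0..1} (monomial_space n m)" for f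
      \<comment> \<open>At the start no zeros are known: the list is empty, \<open>e\<close> is 0
        and the cofactor is \<open>f\<close> itself.\<close>
      using that representation_a[of "m ` {..n}" f "[]" 0 f, OF _ _ _ _ _ card le]
      by (simp add: nonneg_on_def monomial_space_supported)
    show "has_representation_b (n div 2) (m 0) f" if "f \<in> nonneg_on {0..} (monomial_space n m)" for f
      using that representation_b[of "m ` {..n}" f "[]" f, OF _ _ _ _ _ card le]
      by (simp add: nonneg_on_def monomial_space_supported)
  qed
qed

end
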